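(* There exists a univalent function $g\in A$ such that $T_g$ is not bounded on $H^\infty$.
   Context: $\mathbb{D}$ is the open unit disk and $H^\infty$ is the Banach space of bounded analytic functions on $\mathbb{D}$ with the supremum norm. $A$ is the disk algebra: the analytic functions on $\mathbb{D}$ that extend to be continuous on $\overline{\mathbb{D}}$. Univalent means analytic and injective on $\mathbb{D}$. For $g$ analytic on $\mathbb{D}$, $T_gf(z)=\int_0^z f(t)g'(t)\,dt$, $z\in\mathbb{D}$; $T_g$ is bounded on $H^\infty$ if it maps $H^\infty$ into $H^\infty$ as a bounded linear operator. *)

theory Defs
  imports "HOL-Complex_Analysis.Complex_Analysis"
begin

abbreviation unit_disk :: "complex set" where
  "unit_disk \<equiv> ball 0 1"

text \<open>
  Functions on the disk are represented by total functions on \<open>complex\<close>; their values outside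
  the disk play no role in any of the following notions.
\<close>

definition H_inf :: "(complex \<Rightarrow> complex) set" where
  "H_inf = {f. f holomorphic_on unit_disk \<and> bounded (f ` unit_disk)}"

definition H_inf_norm :: "(complex \<Rightarrow> complex) \<Rightarrow> real" where
  "H_inf_norm f = (SUP z\<in>unit_disk. norm (f z))"

definition disk_algebra :: "(complex \<Rightarrow> complex) set" where
  "disk_algebra = {f. f holomorphic_on unit_disk \<and>
     (\<exists>F. continuous_on (closure unit_disk) F \<and> (\<forall>z\<in>unit_disk. F z = f z))}"

definition univalent :: "(complex \<Rightarrow> complex) \<Rightarrow> bool" where
  "univalent f \<longleftrightarrow> f holomorphic_on unit_disk \<and> inj_on f unit_disk"

text \<open>
  For holomorphic \<open>f\<close> and \<open>g\<close> the integral from \<open>0\<close> to \<open>z\<close> is independent of the path in the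
  disk; the straight segment is used.
\<close>

definition volterra_op ::
    "(complex \<Rightarrow> complex) \<Rightarrow> (complex \<Rightarrow> complex) \<Rightarrow> complex \<Rightarrow> complex" where
  "volterra_op g f z = contour_integral (linepath 0 z) (\<lambda>t. f t * deriv g t)"

text \<open>
  Linearity is not part of the following definition: for the operators considered here it always
  holds on the space of bounded holomorphic functions (lemma \<open>volterra_op_linear\<close> below).
\<close>

definition bounded_on_H_inf :: "((complex \<Rightarrow> complex) \<Rightarrow> complex \<Rightarrow> complex) \<Rightarrow> bool" where
  "bounded_on_H_inf T \<longleftrightarrow>
     (\<forall>f\<in>H_inf. T f \<in> H_inf) \<and>
     (\<exists>C. \<forall>f\<in>H_inf. H_inf_norm (T f) \<le> C * H_inf_norm f)"

lemma volterra_op_integrable: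
  assumes "g holomorphic_on unit_disk" "f holomorphic_on unit_disk" "z \<in> unit_disk"
  shows "(\<lambda>t. f t * deriv g t) contour_integrable_on linepath 0 z"
proof (rule contour_integrable_continuous_linepath)
  have "closed_segment 0 z \<subseteq> unit_disk"
    using assms(3) by (intro closed_segment_subset) auto
  moreover have "(\<lambda>t. f t * deriv g t) holomorphic_on unit_disk"
    using assms by (intro holomorphic_intros) auto
  ultimately show "continuous_on (closed_segment 0 z) (\<lambda>t. f t * deriv g t)"
    using continuous_on_subset holomorphic_on_imp_continuous_on by blast
qed

lemma volterra_op_linear:
  assumes "g holomorphic_on unit_disk" "f \<in> H_inf" "h \<in> H_inf" "z \<in> unit_disk"
  shows "volterra_op g (\<lambda>t. a * f t + b * h t) z = a * volterra_op g f z + b * volterra_op g h z"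
proof -
  let ?F = "\<lambda>t. f t * deriv g t" and ?H = "\<lambda>t. h t * deriv g t"
  have F: "?F contour_integrable_on linepath 0 z" and H: "?H contour_integrable_on linepath 0 z"
    using assms by (auto simp: H_inf_def intro!: volterra_op_integrable)
  have "volterra_op g (\<lambda>t. a * f t + b * h t) z
      = contour_integral (linepath 0 z) (\<lambda>t. a * ?F t + b * ?H t)"
    unfolding volterra_op_def by (simp add: algebra_simps)
  also have "\<dots> = a * volterra_op g f z + b * volterra_op g h z"
    unfolding volterra_op_def
    using F H by (simp add: contour_integral_add contour_integral_lmul contour_integrable_lmul)
  finally show ?thesis .
qed

end

theory Submission
  imports Defs
begin

text \<open>
  The function \<open>g\<close> maps the disk onto a ribbon that winds infinitely often around \<open>0\<close> while
  shrinking to \<open>0\<close> so slowly that its centre line has infinite length.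

  Put \<open>\<zeta>(z) = sqrt (10 - Log (1 - z) / 20)\<close> and \<open>g = exp (\<i> \<zeta>) / \<zeta>\<close>. The logarithm takes the disk
  into a half-strip of bounded height, with \<open>1\<close> going to infinity. The square root turns the
  half-strip into a horn around the real axis, in which \<open>Im \<zeta>\<close> is at most \<open>1 / (10 Re \<zeta>)\<close>. On the
  horn \<open>\<bar>exp (\<i> \<zeta>)\<bar>\<close> is bounded above and below, so \<open>g\<close> tends to \<open>0\<close> at \<open>1\<close>, which gives membership
  in the disk algebra. One turn of the spiral \<open>exp (\<i> \<zeta>) / \<zeta>\<close> increases \<open>\<zeta>\<close> by about \<open>2 \<pi>\<close> and
  hence decreases \<open>log \<bar>g\<bar>\<close> by about \<open>2 \<pi> / Re \<zeta>\<close>, whereas across the horn \<open>log \<bar>g\<bar>\<close> varies only by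
  \<open>1 / (5 Re \<zeta>)\<close>. Consecutive turns of the ribbon therefore do not meet, and \<open>g\<close> is
  univalent (\<open>spiral_inj_on_horn\<close>).

  The bounded function \<open>f = exp (- \<i> \<zeta>)\<close> undoes the rotation of \<open>g'\<close>: since
  \<open>f g' = (\<i> / \<zeta> - 1 / \<zeta>\<^sup>2) \<zeta>'\<close>, the function \<open>\<i> Log \<zeta> + 1 / \<zeta>\<close> is a primitive of \<open>f g'\<close>.
  It is unbounded because \<open>\<zeta>\<close> is, so the operator does not even map \<open>H\<^sup>\<infinity>\<close> into itself.
\<close>

section \<open>A spiral over a horn\<close>

text \<open>
  Along the horn the height decays like the reciprocal of the distance to \<open>0\<close>, which is also the
  rate at which the logarithm of the modulus of the spiral below decreases per turn. Small
  constants keep the heights well below that decrease.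
\<close>

definition horn :: "complex set" where
  "horn = {w. 3 < Re w \<and> \<bar>Im w\<bar> * Re w \<le> 1 / 10}"

definition spiral :: "complex \<Rightarrow> complex" where
  "spiral w = exp (\<i> * w) / w"

lemma horn_Im_le:
  assumes "w \<in> horn"
  shows "\<bar>Im w\<bar> \<le> 1 / 30"
proof -
  have "\<bar>Im w\<bar> * 3 \<le> \<bar>Im w\<bar> * Re w"
    using assms by (intro mult_left_mono) (auto simp: horn_def)
  then show ?thesis using assms by (simp add: horn_def)
qed

lemma horn_nonzero: "w \<in> horn \<Longrightarrow> w \<noteq> 0"
  by (auto simp: horn_def)

text \<open>
  The modulus of the real part in the error term makes the bound effective for \<open>u\<close> of moderate
  size near the imaginary axis, where it is applied: there \<open>u\<close> is \<open>\<i>\<close> times the difference of two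
  points of the flat horn.
\<close>

lemma norm_exp_minus_one_ge: "norm u - exp \<bar>Re u\<bar> * (norm u)\<^sup>2 \<le> norm (exp u - 1)"
proof -
  have "norm (exp u - (1 + u)) \<le> exp \<bar>Re u\<bar> * (norm u)\<^sup>2"
    using Taylor_exp[of u 1] by (simp add: numeral_2_eq_2)
  moreover have "norm u \<le> norm (exp u - 1) + norm (exp u - (1 + u))"
    using norm_triangle_ineq4[of "exp u - 1" "exp u - (1 + u)"] by simp
  ultimately show ?thesis by linarith
qed

text \<open>
  Two points of the horn with the same image lie within a fraction of a turn of each other. Equality
  of the moduli reads \<open>\<bar>w2\<bar> = \<bar>w1\<bar> exp (Im w1 - Im w2)\<close>. The exponent is at most \<open>1 / (5 Re w1)\<close> in
  the horn, so the factor exceeds \<open>1\<close> by \<open>O(1 / \<bar>w1\<bar>)\<close> and \<open>\<bar>w2\<bar> - \<bar>w1\<bar>\<close> is bounded by a small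
  constant.
\<close>

lemma spiral_eq_imp_near:
  assumes "w1 \<in> horn" "w2 \<in> horn" "Re w1 \<le> Re w2" "spiral w1 = spiral w2"
  shows "norm (w2 - w1) \<le> 8 / 15"
proof -
  define r where "r = Re w1"
  have r: "3 < r" "r \<le> Re w2" using assms by (auto simp: r_def horn_def)
  have y1: "\<bar>Im w1\<bar> \<le> 1 / 10 / r"
    using assms(1) r by (simp add: horn_def r_def field_simps)
  have "\<bar>Im w2\<bar> * r \<le> \<bar>Im w2\<bar> * Re w2"
    using r by (intro mult_left_mono) auto
  then have y2: "\<bar>Im w2\<bar> \<le> 1 / 10 / r"
    using assms(2) r by (simp add: horn_def field_simps)
  have nz: "w1 \<noteq> 0" "w2 \<noteq> 0" using assms(1,2) by (auto simp: horn_def)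
  have "exp (- Im w1) / norm w1 = exp (- Im w2) / norm w2"
    using arg_cong[OF assms(4), of norm] by (simp add: spiral_def norm_divide)
  then have "norm w2 = norm w1 * exp (Im w1 - Im w2)"
    using nz by (simp add: field_simps exp_diff exp_minus)
  also have "\<dots> \<le> norm w1 * exp (1 / 5 / r)"
    using y1 y2 by (intro mult_left_mono) auto
  also have "\<dots> \<le> norm w1 * (1 + 2 * (1 / 5 / r))"
    using r by (intro mult_left_mono order.trans[OF real_exp_bound_lemma]) (auto simp: field_simps)
  also have "norm w1 \<le> r + 1 / 30"
    using cmod_le[of w1] horn_Im_le[OF assms(1)] r by (simp add: r_def)
  then have "norm w1 * (1 + 2 * (1 / 5 / r)) \<le> (r + 1 / 30) * (1 + 2 * (1 / 5 / r))"
    using r by (intro mult_right_mono) auto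
  also have "\<dots> = r + 1 / 30 + 2 / 5 + 1 / 75 / r"
    using r by (simp add: field_simps)
  also have "1 / 75 / r \<le> 1 / 30"
    using r by (simp add: field_simps)
  finally have "norm w2 \<le> r + 14 / 30"
    by simp
  then have "Re w2 \<le> r + 14 / 30"
    using complex_Re_le_cmod[of w2] by linarith
  then have "\<bar>Re (w2 - w1)\<bar> \<le> 14 / 30" using r by (simp add: r_def)
  moreover have "\<bar>Im (w2 - w1)\<bar> \<le> 2 / 30"
    using horn_Im_le[OF assms(1)] horn_Im_le[OF assms(2)] unfolding minus_complex.sel by linarith
  ultimately show ?thesis using cmod_le[of "w2 - w1"] by linarith
qed

text \<open>
  For nearby points, \<open>exp (\<i> w1) / w1 = exp (\<i> w2) / w2\<close> with \<open>d = w2 - w1\<close> amounts to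
  \<open>exp (\<i> d) - 1 = d / w1\<close>. The left side is about \<open>\<i> d\<close> and the right side has modulus below
  \<open>\<bar>d\<bar> / 3\<close>, which forces \<open>d = 0\<close>.
\<close>

lemma spiral_inj_on_horn: "inj_on spiral horn"
proof -
  have *: "w1 = w2"
    if "w1 \<in> horn" "w2 \<in> horn" "Re w1 \<le> Re w2" "spiral w1 = spiral w2" for w1 w2
  proof (rule ccontr)
    define d where "d = w2 - w1"
    assume "w1 \<noteq> w2"
    then have d0: "0 < norm d" by (simp add: d_def)
    have nz: "w1 \<noteq> 0" "w2 \<noteq> 0" using that(1,2) by (auto simp: horn_def)
    have w1: "3 < norm w1"
      using that(1) complex_Re_le_cmod[of w1] by (simp add: horn_def)
    have near: "norm d \<le> 8 / 15"
      using spiral_eq_imp_near that by (simp add: d_def)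
    have "\<bar>Im d\<bar> \<le> 1 / 30 + 1 / 30"
      using horn_Im_le[OF that(1)] horn_Im_le[OF that(2)] unfolding d_def minus_complex.sel
      by linarith
    then have "exp \<bar>Im d\<bar> \<le> 17 / 15"
      using real_exp_bound_lemma[of "\<bar>Im d\<bar>"] by simp
    then have "exp \<bar>Im d\<bar> * norm d \<le> 17 / 15 * (8 / 15)"
      using near by (intro mult_mono) auto
    then have "norm d * (exp \<bar>Im d\<bar> * norm d) \<le> norm d * (2 / 3)"
      by (intro mult_left_mono) auto
    have "exp (\<i> * d) = w2 / w1"
      using that(4) nz by (simp add: spiral_def d_def right_diff_distrib exp_diff field_simps)
    then have "exp (\<i> * d) - 1 = d / w1"
      using nz by (simp add: d_def field_simps)
    then have "norm (exp (\<i> * d) - 1) = norm d / norm w1"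
      by (simp add: norm_divide)
    also have "\<dots> < norm d / 3"
      using d0 w1 by (intro divide_strict_left_mono) auto
    also have "\<dots> \<le> norm d - exp \<bar>Im d\<bar> * (norm d)\<^sup>2"
      using \<open>norm d * (exp \<bar>Im d\<bar> * norm d) \<le> norm d * (2 / 3)\<close>
      by (simp add: power2_eq_square algebra_simps)
    also have "\<dots> \<le> norm (exp (\<i> * d) - 1)"
      using norm_exp_minus_one_ge[of "\<i> * d"] by (simp add: norm_mult)
    finally show False by simp
  qed
  show ?thesis
    by (intro inj_onI) (metis * linear)
qed

section \<open>Mapping the disk into the horn\<close>

definition horn_map :: "complex \<Rightarrow> complex" where
  "horn_map z = csqrt (10 - Ln (1 - z) / 20)"

lemma unit_disk_punctured: "z \<in> unit_disk \<Longrightarrow> norm z \<le> 1 \<and> z \<noteq> 1"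
  by auto

lemma horn_map_radicand:
  assumes "norm z \<le> 1" "z \<noteq> 1"
  shows "9 < Re (10 - Ln (1 - z) / 20)"
    and "\<bar>Im (10 - Ln (1 - z) / 20)\<bar> \<le> 1 / 5"
    and "1 - z \<notin> \<real>\<^sub>\<le>\<^sub>0"
proof -
  have nz: "1 - z \<noteq> 0" using assms by simp
  have "norm (1 - z) \<le> 2" using norm_triangle_ineq4[of 1 z] assms by simp
  then have "ln (norm (1 - z)) \<le> 2"
    using nz ln_le_minus_one[of "norm (1 - z)"] by simp
  then show "9 < Re (10 - Ln (1 - z) / 20)" using nz by simp
  have "\<bar>Im (Ln (1 - z))\<bar> \<le> pi"
    using mpi_less_Im_Ln[OF nz] Im_Ln_le_pi[OF nz] by linarith
  then show "\<bar>Im (10 - Ln (1 - z) / 20)\<bar> \<le> 1 / 5"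
    using pi_less_4 by simp
  show "1 - z \<notin> \<real>\<^sub>\<le>\<^sub>0"
  proof
    assume "1 - z \<in> \<real>\<^sub>\<le>\<^sub>0"
    then have "Im z = 0" "1 \<le> Re z" by (auto simp: complex_nonpos_Reals_iff)
    moreover have "Re z \<le> 1" using complex_Re_le_cmod[of z] assms by linarith
    ultimately show False using assms by (simp add: complex_eq_iff)
  qed
qed

lemma horn_map_radicand_notin:
  assumes "norm z \<le> 1" "z \<noteq> 1"
  shows "1 - z \<notin> \<real>\<^sub>\<le>\<^sub>0" "10 - Ln (1 - z) / 20 \<notin> \<real>\<^sub>\<le>\<^sub>0"
  using horn_map_radicand(1)[OF assms] horn_map_radicand(3)[OF assms]
  unfolding complex_nonpos_Reals_iff by linarith+

text \<open>
  The radicand \<open>W\<close> lies in a half-strip, and \<open>w\<^sup>2 = W\<close> gives \<open>2 Re w Im w = Im W\<close>. Bounded height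
  of the half-strip thus becomes height \<open>O(1 / Re w)\<close> for the root.
\<close>

lemma horn_map_in_horn:
  assumes "norm z \<le> 1" "z \<noteq> 1"
  shows "horn_map z \<in> horn"
proof -
  define W where "W = 10 - Ln (1 - z) / 20"
  define w where "w = csqrt W"
  have sq: "w ^ 2 = W" by (simp add: w_def)
  have "Re W = (Re w)\<^sup>2 - (Im w)\<^sup>2" by (simp add: Re_power2 flip: sq)
  moreover have "9 < Re W" using horn_map_radicand[OF assms] by (simp add: W_def)
  ultimately have "3 ^ 2 < (Re w) ^ 2"
    using zero_le_power2[of "Im w"] unfolding power2_eq_square by linarith
  moreover have "0 \<le> Re w" using csqrt_principal[of W] by (auto simp: w_def)
  ultimately have "3 < Re w" using power2_less_imp_less by blast
  moreover have "Im W = 2 * Re w * Im w" by (simp add: Im_power2 flip: sq)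
  then have "2 * (\<bar>Im w\<bar> * Re w) = \<bar>Im W\<bar>"
    using \<open>0 \<le> Re w\<close> by (simp add: abs_mult)
  ultimately show ?thesis
    using horn_map_radicand(2)[OF assms] by (simp add: horn_def horn_map_def W_def w_def)
qed

lemma horn_map_inj_on: "inj_on horn_map unit_disk"
proof (rule inj_onI)
  fix z1 z2 assume z: "z1 \<in> unit_disk" "z2 \<in> unit_disk" and "horn_map z1 = horn_map z2"
  then have "(horn_map z1)\<^sup>2 = (horn_map z2)\<^sup>2" by simp
  then have "Ln (1 - z1) = Ln (1 - z2)" by (simp add: horn_map_def)
  moreover have "1 - z1 \<noteq> 0" "1 - z2 \<noteq> 0" using z by auto
  ultimately have "1 - z1 = 1 - z2" by (metis exp_Ln)
  then show "z1 = z2" by simp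
qed

lemma horn_map_holomorphic: "horn_map holomorphic_on unit_disk"
proof -
  have "1 - z \<notin> \<real>\<^sub>\<le>\<^sub>0" "10 - Ln (1 - z) / 20 \<notin> \<real>\<^sub>\<le>\<^sub>0" if "z \<in> unit_disk" for z
    using horn_map_radicand_notin[of z] unit_disk_punctured[of z] that by auto
  then show ?thesis
    unfolding horn_map_def by (intro holomorphic_intros) auto
qed

lemma horn_map_continuous: "continuous_on (cball 0 1 - {1}) horn_map"
proof -
  have "1 - z \<notin> \<real>\<^sub>\<le>\<^sub>0" "10 - Ln (1 - z) / 20 \<notin> \<real>\<^sub>\<le>\<^sub>0" if "z \<in> cball 0 1 - {1}" for z
    using horn_map_radicand_notin[of z] unit_disk_punctured[of z] that by auto
  then show ?thesis
    unfolding horn_map_def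
    by (intro continuous_on_compose2[OF holomorphic_on_imp_continuous_on[OF holomorphic_on_csqrt]]
        continuous_intros) auto
qed

lemma norm_horn_map_ge:
  assumes "z \<noteq> 1"
  shows "10 - ln (norm (1 - z)) / 20 \<le> (norm (horn_map z))\<^sup>2"
proof -
  have "10 - ln (norm (1 - z)) / 20 = Re (10 - Ln (1 - z) / 20)"
    using assms by simp
  also have "\<dots> \<le> norm (10 - Ln (1 - z) / 20)" by (rule complex_Re_le_cmod)
  also have "\<dots> = (norm (horn_map z))\<^sup>2"
    by (simp add: horn_map_def flip: norm_power)
  finally show ?thesis .
qed

lemma horn_map_at_infinity: "filterlim horn_map at_infinity (at 1)"
proof -
  have "filterlim (\<lambda>z::complex. 10 - ln (norm (1 - z)) / 20) at_top (at 1)"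
  proof -
    have "filterlim (\<lambda>z::complex. norm (1 - z)) (at_right 0) (at 1)"
      unfolding filterlim_at
      by (auto intro!: tendsto_eq_intros simp: eventually_at_filter)
    then have "filterlim (\<lambda>z::complex. ln (norm (1 - z))) at_bot (at 1)"
      by (rule filterlim_compose[OF ln_at_0])
    then have "filterlim (\<lambda>z::complex. - ln (norm (1 - z)) * (1 / 20)) at_top (at 1)"
      by (intro filterlim_at_top_mult_tendsto_pos[OF tendsto_const])
        (auto simp: filterlim_uminus_at_top)
    then show ?thesis
      using filterlim_tendsto_add_at_top[OF tendsto_const[of 10]] by fastforce
  qed
  then have "filterlim (\<lambda>z. (norm (horn_map z))\<^sup>2) at_top (at 1)"
    by (rule filterlim_at_top_mono)
       (auto intro!: norm_horn_map_ge always_eventually simp: eventually_at_filter)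
  then have "filterlim (\<lambda>z. sqrt ((norm (horn_map z))\<^sup>2)) at_top (at 1)"
    by (rule filterlim_compose[OF sqrt_at_top])
  then show ?thesis
    by (simp add: filterlim_at_infinity_conv_norm_at_top)
qed

section \<open>The univalent function\<close>

definition spiral_map :: "complex \<Rightarrow> complex" where
  "spiral_map z = spiral (horn_map z)"

lemma norm_spiral_le:
  assumes "w \<in> horn"
  shows "norm (spiral w) \<le> norm (2 / w)"
proof -
  have "exp (- Im w) \<le> 1 + 2 * (1 / 30)"
    using horn_Im_le[OF assms] order.trans[OF _ real_exp_bound_lemma[of "1 / 30"]] by auto
  then show ?thesis
    by (auto simp: spiral_def norm_divide intro: divide_right_mono)
qed

lemma spiral_map_holomorphic: "spiral_map holomorphic_on unit_disk"
proof -
  have "horn_map z \<noteq> 0" if "z \<in> unit_disk" for z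
    using horn_nonzero[OF horn_map_in_horn[of z]] unit_disk_punctured[of z] that by auto
  then show ?thesis
    unfolding spiral_map_def spiral_def
    by (intro holomorphic_intros horn_map_holomorphic) auto
qed

lemma spiral_map_univalent: "univalent spiral_map"
proof -
  have "horn_map ` unit_disk \<subseteq> horn"
    using horn_map_in_horn unit_disk_punctured by blast
  then have "inj_on (spiral \<circ> horn_map) unit_disk"
    by (intro comp_inj_on horn_map_inj_on inj_on_subset[OF spiral_inj_on_horn])
  then show ?thesis
    by (simp add: univalent_def spiral_map_holomorphic spiral_map_def o_def inj_on_def)
qed

lemma spiral_map_tendsto_0: "(spiral_map \<longlongrightarrow> 0) (at 1 within cball 0 1)"
proof (rule Lim_null_comparison)
  show "\<forall>\<^sub>F z in at 1 within cball 0 1. norm (spiral_map z) \<le> norm (2 / horn_map z)"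
    unfolding eventually_at_filter spiral_map_def
    by (intro always_eventually allI impI norm_spiral_le horn_map_in_horn) auto
  have "((\<lambda>z. 2 / horn_map z) \<longlongrightarrow> 0) (at 1)"
    by (rule tendsto_divide_0[OF tendsto_const horn_map_at_infinity])
  then show "((\<lambda>z. norm (2 / horn_map z)) \<longlongrightarrow> 0) (at 1 within cball 0 1)"
    by (intro tendsto_norm_zero) (rule tendsto_within_subset, auto)
qed

lemma spiral_map_disk_algebra: "spiral_map \<in> disk_algebra"
proof -
  define F where "F = (\<lambda>z. if z = 1 then 0 else spiral_map z)"
  have nz: "horn_map z \<noteq> 0" if "z \<in> cball 0 1 - {1}" for z
    using horn_nonzero[OF horn_map_in_horn[of z]] unit_disk_punctured[of z] that by auto
  have cont: "continuous_on (cball 0 1 - {1}) spiral_map"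
    unfolding spiral_map_def spiral_def
    by (intro continuous_intros horn_map_continuous) (use nz in auto)
  have "continuous_on (cball 0 1) F"
    unfolding continuous_on_eq_continuous_within
  proof
    fix z :: complex assume z: "z \<in> cball 0 1"
    show "continuous (at z within cball 0 1) F"
    proof (cases "z = 1")
      case True
      have "(F \<longlongrightarrow> 0) (at 1 within cball 0 1) \<longleftrightarrow> (spiral_map \<longlongrightarrow> 0) (at 1 within cball 0 1)"
        by (intro filterlim_cong refl) (auto simp: F_def eventually_at_filter)
      then show ?thesis
        using True spiral_map_tendsto_0 by (simp add: continuous_within F_def)
    next
      case False
      have "continuous_on (cball 0 1 - {1}) F"
        using cont by (rule continuous_on_eq) (auto simp: F_def)
      then have "continuous (at z within cball 0 1 - {1}) F"
        using z False by (simp add: continuous_on_eq_continuous_within)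
      moreover have "at z within cball 0 1 - {1} = at z within cball 0 1"
        using False by (intro at_within_nhd[of _ "- {1}"]) auto
      ultimately show ?thesis by simp
    qed
  qed
  then have "continuous_on (closure unit_disk) F" by simp
  moreover have "\<forall>z\<in>unit_disk. F z = spiral_map z" by (auto simp: F_def)
  ultimately show ?thesis
    using spiral_map_holomorphic by (auto simp: disk_algebra_def)
qed

section \<open>Unboundedness of the integral operator\<close>

text \<open>
  The factor that cancels the rotation \<open>exp (\<i> \<zeta>)\<close> in \<open>spiral_map\<close> and in its derivative.
\<close>

definition unwind :: "complex \<Rightarrow> complex" where
  "unwind z = exp (- \<i> * horn_map z)"

lemma unwind_in_H_inf: "unwind \<in> H_inf"
proof -
  have "norm (unwind z) \<le> exp 1" if "z \<in> unit_disk" for z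
    using horn_Im_le[OF horn_map_in_horn[of z]] unit_disk_punctured[OF that]
    by (simp add: unwind_def)
  moreover have "unwind holomorphic_on unit_disk"
    unfolding unwind_def by (intro holomorphic_intros horn_map_holomorphic)
  ultimately show ?thesis
    unfolding H_inf_def bounded_iff by blast
qed

text \<open>
  The map \<open>P\<close> is a primitive of \<open>\<i> / w - 1 / w\<^sup>2\<close>, which is \<open>exp (- \<i> w)\<close> times the derivative of the
  spiral.
\<close>

lemma volterra_spiral_unwind:
  assumes "z \<in> unit_disk"
  defines "P \<equiv> \<lambda>w. \<i> * Ln w + 1 / w"
  shows "volterra_op spiral_map unwind z = P (horn_map z) - P (horn_map 0)"
proof -
  have deriv: "((\<lambda>t. P (horn_map t)) has_field_derivative unwind t * deriv spiral_map t)
      (at t within unit_disk)" if t: "t \<in> unit_disk" for t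
  proof -
    define D where "D = deriv horn_map t"
    have h: "(horn_map has_field_derivative D) (at t)"
      using holomorphic_derivI[OF horn_map_holomorphic _ t] by (simp add: D_def)
    have "horn_map t \<in> horn" using horn_map_in_horn unit_disk_punctured[OF t] by blast
    then have nz: "horn_map t \<noteq> 0" "horn_map t \<notin> \<real>\<^sub>\<le>\<^sub>0"
      by (auto simp: horn_def complex_nonpos_Reals_iff)
    have "(spiral_map has_field_derivative
        (exp (\<i> * horn_map t) * (\<i> * D) * horn_map t - exp (\<i> * horn_map t) * D)
          / (horn_map t * horn_map t)) (at t)"
      unfolding spiral_map_def spiral_def
      by (rule derivative_eq_intros h nz refl | simp)+
    then have "deriv spiral_map t =
        exp (\<i> * horn_map t) * ((\<i> / horn_map t - 1 / (horn_map t)\<^sup>2) * D)"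
      using nz by (subst DERIV_imp_deriv) (auto simp: field_simps power2_eq_square)
    then have "unwind t * deriv spiral_map t = (\<i> / horn_map t - 1 / (horn_map t)\<^sup>2) * D"
      by (simp add: unwind_def exp_minus field_simps)
    moreover have "((\<lambda>t. P (horn_map t)) has_field_derivative
        (\<i> / horn_map t - 1 / (horn_map t)\<^sup>2) * D) (at t)"
      unfolding P_def
      by (rule derivative_eq_intros h nz refl | (use nz in \<open>simp add: field_simps power2_eq_square\<close>))+
    ultimately show ?thesis
      by (simp add: has_field_derivative_at_within)
  qed
  have "path_image (linepath 0 z) \<subseteq> unit_disk"
    using assms(1) by (simp add: closed_segment_subset)
  then have "((\<lambda>t. unwind t * deriv spiral_map t) has_contour_integral
      P (horn_map (pathfinish (linepath 0 z))) - P (horn_map (pathstart (linepath 0 z))))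
      (linepath 0 z)"
    by (intro contour_integral_primitive[OF deriv]) auto
  then show ?thesis
    unfolding volterra_op_def by (auto dest: contour_integral_unique)
qed

text \<open>
  A bound on the integral would bound \<open>Log \<zeta>\<close>, the term \<open>1 / \<zeta>\<close> being bounded on the horn, and hence
  \<open>\<zeta>\<close> itself, against \<open>\<zeta> \<rightarrow> \<infinity>\<close> at the boundary point \<open>1\<close>.
\<close>

lemma volterra_spiral_unwind_notin_H_inf: "volterra_op spiral_map unwind \<notin> H_inf"
proof
  assume "volterra_op spiral_map unwind \<in> H_inf"
  then obtain B where B: "\<And>z. z \<in> unit_disk \<Longrightarrow> norm (volterra_op spiral_map unwind z) \<le> B"
    unfolding H_inf_def bounded_iff by blast
  define c where "c = \<i> * Ln (horn_map 0) + 1 / horn_map 0"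
  have le: "norm (horn_map z) \<le> exp (B + norm c + 1)" if z: "z \<in> unit_disk" for z
  proof -
    let ?w = "horn_map z"
    have "?w \<in> horn" using horn_map_in_horn unit_disk_punctured[OF z] by blast
    then have w: "3 < norm ?w" using complex_Re_le_cmod[of ?w] by (simp add: horn_def)
    then have nz: "?w \<noteq> 0" by auto
    have "\<i> * Ln ?w = volterra_op spiral_map unwind z + c - 1 / ?w"
      using volterra_spiral_unwind[OF z] by (simp add: c_def)
    then have "norm (Ln ?w) = norm (volterra_op spiral_map unwind z + c - 1 / ?w)"
      by (metis norm_ii norm_mult mult_1)
    also have "\<dots> \<le> norm (volterra_op spiral_map unwind z) + norm c + norm (1 / ?w)"
      by (meson add_mono norm_triangle_ineq norm_triangle_ineq4 order_refl order_trans)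
    also have "norm (1 / ?w) \<le> 1" using w by (simp add: norm_divide divide_le_eq_1)
    finally have "ln (norm ?w) \<le> B + norm c + 1"
      using B[OF z] complex_Re_le_cmod[of "Ln ?w"] nz by simp
    then have "exp (ln (norm ?w)) \<le> exp (B + norm c + 1)" by simp
    then show ?thesis using nz by simp
  qed
  have "\<forall>\<^sub>F z in at 1 within unit_disk. exp (B + norm c + 1) < norm (horn_map z)"
    using horn_map_at_infinity
    by (auto simp: filterlim_at_infinity_conv_norm_at_top filterlim_at_top_dense
        intro: filter_leD[OF at_le[of unit_disk UNIV 1]])
  moreover have "\<forall>\<^sub>F z in at 1 within unit_disk. z \<in> unit_disk"
    by (simp add: eventually_at_filter)
  ultimately have "\<forall>\<^sub>F z in at (1::complex) within unit_disk. False"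
    by eventually_elim (use le in fastforce)
  moreover have "(1::complex) islimpt unit_disk"
    by (simp add: islimpt_ball)
  ultimately show False
    by (simp add: trivial_limit_within eventually_False)
qed

theorem proposition2p14:
  shows "\<exists>g. univalent g \<and> g \<in> disk_algebra \<and> \<not> bounded_on_H_inf (volterra_op g)"
proof (intro exI conjI)
  show "univalent spiral_map" by (rule spiral_map_univalent)
  show "spiral_map \<in> disk_algebra" by (rule spiral_map_disk_algebra)
  show "\<not> bounded_on_H_inf (volterra_op spiral_map)"
    using unwind_in_H_inf volterra_spiral_unwind_notin_H_inf
    by (auto simp: bounded_on_H_inf_def)
qed

end
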